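(* Let $\mathcal D$ be the data of a Separated Det-POMDP whose sets $\mathbb T,\mathbb X,\mathbb U,\mathbb O$ are finite. Then, for every initial belief $b_0\in\Delta(\mathbb X)$, the set $\mathcal R^{\mathcal D}_{[1,T]}(b_0)$ of reachable beliefs starting from $b_0$ satisfies $$\bigl|\mathcal R^{\mathcal D}_{[1,T]}(b_0)\bigr|\;\le\;1+\bigl(2^{|\mathrm{supp}(b_0)|}-|\mathrm{supp}(b_0)|\bigr)\,|\mathbb X| .$$
   Context: **Det-POMDP data.** A Det-POMDP is given by $\mathcal D=(\mathbb T,\mathbb U,\mathbb O,\mathbb X,(\mathcal L_t)_{t\in\mathbb T},(\varphi_t)_{t\in\mathbb T\setminus\{T\}},(\mathbb U^{\mathrm{ad}}_t)_{t\in\mathbb T\setminus\{T\}},(\beta_t)_{t\in\mathbb T})$, where $\mathbb T=\{0,1,\dots,T\}$ is the set of stages with horizon an integer $T\ge 1$; $\mathbb U,\mathbb O,\mathbb X$ are the sets of controls, observations and states; $\mathcal L_t:\mathbb X\times\mathbb U\to\mathbb R\cup\{+\infty\}$ ($t<T$) and $\mathcal L_T:\mathbb X\to\mathbb R\cup\{+\infty\}$ are costs; $\varphi_t:\mathbb X\times\mathbb U\to\mathbb X$ are the dynamics; $\mathbb U^{\mathrm{ad}}_t:\mathbb X\rightrightarrows\mathbb U$ are set-valued admissibility constraints; $\beta_0:\mathbb X\to\mathbb O$ and $\beta_t:\mathbb X\times\mathbb U\to\mathbb O$ ($t\ge1$) are observation mappings. Write $\varphi_t^u=\varphi_t(\cdot,u)$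 and $\beta_t^u=\beta_t(\cdot,u)$. **Beliefs.** $\Delta(\mathbb Y)$ is the set of probability distributions on a finite set $\mathbb Y$; $\mathrm{supp}(\mu)=\{y:\mu(\{y\})>0\}$; $|\cdot|$ is cardinality. Let $\partial\notin\mathbb X$, $\overline{\mathbb X}=\mathbb X\cup\{\partial\}$, let $\delta_\partial$ be the Dirac measure at $\partial$, and let $\mathbb B=\Delta(\mathbb X)\cup\{\delta_\partial\}\subset\Delta(\overline{\mathbb X})$, where $\Delta(\mathbb X)$ is identified with the probabilities on $\overline{\mathbb X}$ supported in $\mathbb X$. **Belief dynamics.** For $t\in\mathbb T\setminus\{T\}$ and $(b,u,o)\in\mathbb B\times\mathbb U\times\mathbb O$, let $Q_{t+1}(b,u,o)=b\bigl((\beta^u_{t+1}\circ\varphi^u_t)^{-1}(o)\bigr)$. Define $\theta_t:\mathbb B\times\mathbb U\times\mathbb O\to\mathbb B$ by: for $y\in\mathbb X$, $\theta_t(b,u,o)(y)=b\bigl((\varphi_t^u)^{-1}(y)\bigr)/Q_{t+1}(b,u,o)$ if $Q_{t+1}(b,u,o)\ne0$ and $y\in(\beta_{t+1}^u)^{-1}(o)$, and $\theta_t(b,u,o)(y)=0$ otherwise; and $\theta_t(b,u,o)(\partial)=1-\theta_t(b,u,o)(\mathbb X)$. **Reachable beliefs.** $\mathcal R^{\mathcal D}_0(b_0)=\{b_0\}$, $\mathcal R^{\mathcal D}_{t+1}(b_0)=\{\theta_t(b,u,o): b\in\mathcal R^{\mathcal D}_t(b_0),u\in\mathbb U,o\in\mathbb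 O\}$ for $t<T$, and $\mathcal R^{\mathcal D}_{[1,T]}(b_0)=\bigcup_{t=1}^T\mathcal R^{\mathcal D}_t(b_0)$. **Separated Det-POMDP.** For $t\in\mathbb T\setminus\{T\}$ and $(u,o)\in\mathbb U\times\mathbb O$, define $\phi_t^{u,o}:\overline{\mathbb X}\to\overline{\mathbb X}$ by $\phi_t^{u,o}(\bar x)=\varphi_t^u(\bar x)$ if $\bar x\ne\partial$ and $\varphi_t^u(\bar x)\in(\beta_{t+1}^u)^{-1}(o)$, and $\phi_t^{u,o}(\bar x)=\partial$ otherwise. Let $\Phi^{\mathcal D}_t=\{\phi_t^{u,o}:u\in\mathbb U,o\in\mathbb O\}$, $\Phi^{\mathcal D}_{0:t}=\{g_t\circ\cdots\circ g_0: g_s\in\Phi^{\mathcal D}_s,\ 0\le s\le t\}$ and $\Phi^{\mathcal D}=\bigcup_{t\in\mathbb T\setminus\{T\}}\Phi^{\mathcal D}_{0:t}$. A pair $(g_1,g_2)$ of self-mappings of $\overline{\mathbb X}$ is $(\partial)$-separated if, with $A=g_1^{-1}(\mathbb X)\cap g_2^{-1}(\mathbb X)$, whenever $g_1(x)=g_2(x)$ for some $x\in A$, then $g_1$ and $g_2$ coincide on all of $A$. A set of self-mappings of $\overline{\mathbb X}$ is a $(\partial)$-separated mapping set if all ordered pairs of its elements are $(\partial)$-separated. A Separated Det-POMDP is a Det-POMDP such that $\Phi^{\mathcal D}$ is a $(\partial)$-separated mapping set. *)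

theory Defs
  imports "HOL-Probability.Probability"
begin

text \<open>
  States, controls and observations are the elements of the types 'x, 'u, 'o.
  Stage-indexed components are total functions of the stage; only the values at stages where
  the component exists matter (0..<T for the running cost, dynamics and admissible controls,
  1..T for obs).
\<close>

record ('x, 'u, 'o) pomdp_data =
  horizon    :: nat
  run_cost   :: "nat \<Rightarrow> 'x \<Rightarrow> 'u \<Rightarrow> ereal"
  final_cost :: "'x \<Rightarrow> ereal"
  dyn        :: "nat \<Rightarrow> 'x \<Rightarrow> 'u \<Rightarrow> 'x"
  admissible :: "nat \<Rightarrow> 'x \<Rightarrow> 'u set"
  obs0       :: "'x \<Rightarrow> 'o"
  obs        :: "nat \<Rightarrow> 'x \<Rightarrow> 'u \<Rightarrow> 'o"

definition det_pomdp :: "('x, 'u, 'o) pomdp_data \<Rightarrow> bool" where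
  "det_pomdp D \<longleftrightarrow>
     1 \<le> horizon D \<and>
     (\<forall>t < horizon D. \<forall>x u. run_cost D t x u \<noteq> -\<infinity>) \<and>
     (\<forall>x. final_cost D x \<noteq> -\<infinity>)"

text \<open>
  The cemetery point is None, so the extended state space is the type 'x option and the
  identification of distributions on 'x with distributions on 'x option supported in 'x is
  map_pmf Some.
\<close>

definition beliefs :: "'x option pmf set" where
  "beliefs = range (map_pmf Some) \<union> {return_pmf None}"

definition obs_prob ::
  "('x, 'u, 'o) pomdp_data \<Rightarrow> nat \<Rightarrow> 'x option pmf \<Rightarrow> 'u \<Rightarrow> 'o \<Rightarrow> real" where
  "obs_prob D t b u z =
     measure_pmf.prob b (Some ` (((\<lambda>y. obs D (Suc t) y u) \<circ> (\<lambda>x. dyn D t x u)) -` {z}))"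

definition theta_state_mass ::
  "('x, 'u, 'o) pomdp_data \<Rightarrow> nat \<Rightarrow> 'x option pmf \<Rightarrow> 'u \<Rightarrow> 'o \<Rightarrow> 'x \<Rightarrow> real" where
  "theta_state_mass D t b u z y =
     (if obs_prob D t b u z \<noteq> 0 \<and> y \<in> (\<lambda>y. obs D (Suc t) y u) -` {z}
      then measure_pmf.prob b (Some ` ((\<lambda>x. dyn D t x u) -` {y})) / obs_prob D t b u z
      else 0)"

definition theta_mass ::
  "('x::finite, 'u, 'o) pomdp_data \<Rightarrow> nat \<Rightarrow> 'x option pmf \<Rightarrow> 'u \<Rightarrow> 'o \<Rightarrow> 'x option \<Rightarrow> real" where
  "theta_mass D t b u z yb =
     (case yb of
        Some y \<Rightarrow> theta_state_mass D t b u z y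
      | None \<Rightarrow> 1 - (\<Sum>y\<in>UNIV. theta_state_mass D t b u z y))"

text \<open>Lemma pmf_theta below shows that theta_mass always is a probability mass function.\<close>

definition theta ::
  "('x::finite, 'u, 'o) pomdp_data \<Rightarrow> nat \<Rightarrow> 'x option pmf \<Rightarrow> 'u \<Rightarrow> 'o \<Rightarrow> 'x option pmf" where
  "theta D t b u z = embed_pmf (theta_mass D t b u z)"

primrec reachable ::
  "('x::finite, 'u, 'o) pomdp_data \<Rightarrow> 'x option pmf \<Rightarrow> nat \<Rightarrow> 'x option pmf set" where
  "reachable D b0 0 = {b0}"
| "reachable D b0 (Suc t) = {theta D t b u z | b u z. b \<in> reachable D b0 t}"

definition reachable_beliefs ::
  "('x::finite, 'u, 'o) pomdp_data \<Rightarrow> 'x option pmf \<Rightarrow> 'x option pmf set" where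
  "reachable_beliefs D b0 = (\<Union>t\<in>{1..horizon D}. reachable D b0 t)"

definition phi ::
  "('x, 'u, 'o) pomdp_data \<Rightarrow> nat \<Rightarrow> 'u \<Rightarrow> 'o \<Rightarrow> 'x option \<Rightarrow> 'x option" where
  "phi D t u z xb =
     (case xb of
        Some x \<Rightarrow> if dyn D t x u \<in> (\<lambda>y. obs D (Suc t) y u) -` {z}
                  then Some (dyn D t x u) else None
      | None \<Rightarrow> None)"

definition Phi_stage ::
  "('x, 'u, 'o) pomdp_data \<Rightarrow> nat \<Rightarrow> ('x option \<Rightarrow> 'x option) set" where
  "Phi_stage D t = {phi D t u z | u z. True}"

primrec Phi_upto ::
  "('x, 'u, 'o) pomdp_data \<Rightarrow> nat \<Rightarrow> ('x option \<Rightarrow> 'x option) set" where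
  "Phi_upto D 0 = Phi_stage D 0"
| "Phi_upto D (Suc t) = {g \<circ> h | g h. g \<in> Phi_stage D (Suc t) \<and> h \<in> Phi_upto D t}"

definition Phi :: "('x, 'u, 'o) pomdp_data \<Rightarrow> ('x option \<Rightarrow> 'x option) set" where
  "Phi D = (\<Union>t<horizon D. Phi_upto D t)"

definition separated_pair ::
  "('x option \<Rightarrow> 'x option) \<Rightarrow> ('x option \<Rightarrow> 'x option) \<Rightarrow> bool" where
  "separated_pair g1 g2 \<longleftrightarrow>
     (let A = g1 -` range Some \<inter> g2 -` range Some
      in (\<exists>x\<in>A. g1 x = g2 x) \<longrightarrow> (\<forall>x\<in>A. g1 x = g2 x))"

definition separated_mapping_set :: "('x option \<Rightarrow> 'x option) set \<Rightarrow> bool" where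
  "separated_mapping_set G \<longleftrightarrow> (\<forall>g1\<in>G. \<forall>g2\<in>G. separated_pair g1 g2)"

definition separated_det_pomdp :: "('x, 'u, 'o) pomdp_data \<Rightarrow> bool" where
  "separated_det_pomdp D \<longleftrightarrow> det_pomdp D \<and> separated_mapping_set (Phi D)"

lemma theta_state_mass_nonneg: "0 \<le> theta_state_mass D t b u z y"
  by (simp add: theta_state_mass_def obs_prob_def)

lemma sum_theta_state_mass:
  fixes D :: "('x::finite, 'u, 'o) pomdp_data"
  shows "(\<Sum>y\<in>UNIV. theta_state_mass D t b u z y) = (if obs_prob D t b u z = 0 then 0 else 1)"
proof (cases "obs_prob D t b u z = 0")
  case True
  then show ?thesis by (simp add: theta_state_mass_def)
next
  case False
  let ?Y = "{y. obs D (Suc t) y u = z}"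
  let ?P = "\<lambda>y. Some ` ((\<lambda>x. dyn D t x u) -` {y})"
  have "(\<Sum>y\<in>UNIV. theta_state_mass D t b u z y)
      = (\<Sum>y\<in>?Y. measure_pmf.prob b (?P y) / obs_prob D t b u z)"
    by (rule sum.mono_neutral_cong_right) (auto simp: theta_state_mass_def False)
  also have "\<dots> = (\<Sum>y\<in>?Y. measure_pmf.prob b (?P y)) / obs_prob D t b u z"
    by (simp add: sum_divide_distrib)
  also have "(\<Sum>y\<in>?Y. measure_pmf.prob b (?P y)) = measure_pmf.prob b (\<Union>y\<in>?Y. ?P y)"
    by (rule measure_pmf.finite_measure_finite_Union[symmetric])
       (auto simp: disjoint_family_on_def)
  also have "(\<Union>y\<in>?Y. ?P y)
      = Some ` (((\<lambda>y. obs D (Suc t) y u) \<circ> (\<lambda>x. dyn D t x u)) -` {z})"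
    by auto
  finally show ?thesis using False by (simp add: obs_prob_def)
qed

lemma pmf_theta:
  fixes D :: "('x::finite, 'u, 'o) pomdp_data"
  shows "pmf (theta D t b u z) yb = theta_mass D t b u z yb"
  unfolding theta_def
proof (rule pmf_embed_pmf)
  show nonneg: "0 \<le> theta_mass D t b u z y" for y
    by (auto simp: theta_mass_def theta_state_mass_nonneg sum_theta_state_mass split: option.split)
  have "(\<integral>\<^sup>+ y. ennreal (theta_mass D t b u z y) \<partial>count_space UNIV)
      = (\<Sum>y\<in>UNIV. ennreal (theta_mass D t b u z y))"
    by (rule nn_integral_count_space_finite) simp
  also have "\<dots> = ennreal (\<Sum>y\<in>UNIV. theta_mass D t b u z y)"
    by (simp add: nonneg sum_ennreal)
  also have "(\<Sum>y\<in>UNIV. theta_mass D t b u z y) = 1"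
    by (simp add: UNIV_option_conv sum.reindex theta_mass_def)
  finally show "(\<integral>\<^sup>+ y. ennreal (theta_mass D t b u z y) \<partial>count_space UNIV) = 1"
    by simp
qed

lemma theta_in_beliefs: "theta D t b u z \<in> beliefs"
proof (cases "obs_prob D t b u z = 0")
  case True
  have "theta D t b u z = return_pmf None"
    by (rule pmf_eqI)
       (auto simp: pmf_theta theta_mass_def sum_theta_state_mass True theta_state_mass_def
             split: option.split)
  then show ?thesis by (simp add: beliefs_def)
next
  case False
  let ?p = "theta D t b u z"
  have "pmf ?p None = 0"
    by (simp add: pmf_theta theta_mass_def sum_theta_state_mass False)
  then have "None \<notin> set_pmf ?p" by (simp add: set_pmf_iff)
  then have "map_pmf (Some \<circ> the) ?p = map_pmf id ?p"
    by (intro map_pmf_cong refl) (metis comp_apply id_apply option.collapse)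
  then have "?p = map_pmf Some (map_pmf the ?p)"
    by (simp add: pmf.map_comp pmf.map_id)
  then show ?thesis unfolding beliefs_def by blast
qed

lemma finite_reachable_beliefs:
  fixes D :: "('x::finite, 'u::finite, 'o::finite) pomdp_data"
  shows "finite (reachable_beliefs D b0)"
proof -
  have "finite (reachable D b0 t)" for t
  proof (induction t)
    case (Suc t)
    have "reachable D b0 (Suc t)
        = (\<lambda>(b, u, z). theta D t b u z) ` (reachable D b0 t \<times> UNIV \<times> UNIV)"
      by (auto simp: image_iff; blast)
    with Suc show ?case by simp
  qed simp
  then show ?thesis by (simp add: reachable_beliefs_def)
qed

end

theory Submission
  imports Defs
begin

text \<open>
  Every belief reachable at a stage at least 1 is, away from the cemetery point, proportional to
  the image of the initial belief under some mapping \<open>g\<close> in \<open>Phi D\<close>. If it is not the cemetery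
  belief, let \<open>A\<close> be the nonempty set of initial support points that \<open>g\<close> keeps alive. By
  separation, \<open>A\<close> and the value of \<open>g\<close> at a single chosen point of \<open>A\<close> determine \<open>g\<close> on \<open>A\<close>,
  hence the belief; this leaves at most one belief per pair of a set \<open>A\<close> and a state. When \<open>A\<close> is
  a singleton, the belief is a Dirac measure, so the \<open>n\<close> singletons together contribute only as
  many beliefs as there are states. All of them share the code \<open>{}\<close>, which is otherwise
  unused, so the sets that occur as codes are the \<open>2 ^ n - n\<close> non-singleton subsets of the support.
\<close>

text \<open>Only state masses are compared: conditioning on an observation discards the mass sent to
  the cemetery point, and \<open>c\<close> records the renormalization. The value
  \<open>c = 0\<close> covers the cemetery belief.\<close>

definition scaled_image ::
  "('x option \<Rightarrow> 'x option) \<Rightarrow> 'x option pmf \<Rightarrow> 'x option pmf \<Rightarrow> bool" where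
  "scaled_image g p b \<longleftrightarrow> (\<exists>c. \<forall>y. pmf b (Some y) = c * pmf (map_pmf g p) (Some y))"

definition alive :: "('x option \<Rightarrow> 'x option) \<Rightarrow> 'x pmf \<Rightarrow> 'x set" where
  "alive g p = {x \<in> set_pmf p. g (Some x) \<noteq> None}"

lemma phi_eq_Some_iff:
  "phi D t u z xb = Some y \<longleftrightarrow> xb \<in> Some ` ((\<lambda>x. dyn D t x u) -` {y}) \<and> obs D (Suc t) y u = z"
  by (auto simp: phi_def split: option.splits)

text \<open>The division by zero when \<open>obs_prob\<close> vanishes yields the value 0 that \<open>theta\<close> prescribes.\<close>

lemma pmf_theta_Some:
  fixes D :: "('x::finite, 'u, 'o) pomdp_data"
  shows "pmf (theta D t b u z) (Some y) = pmf (map_pmf (phi D t u z) b) (Some y) / obs_prob D t b u z"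
proof -
  have "phi D t u z -` {Some y} =
      (if obs D (Suc t) y u = z then Some ` ((\<lambda>x. dyn D t x u) -` {y}) else {})"
    by (auto simp: phi_eq_Some_iff)
  then show ?thesis
    by (simp add: pmf_theta theta_mass_def theta_state_mass_def pmf_map)
qed

text \<open>Since \<open>phi\<close> fixes \<open>None\<close>, the preimage of a state consists of
  states only, so the unconstrained mass of \<open>b\<close> at \<open>None\<close> never enters;
  \<open>c\<close> merely gets divided by the observation probability.\<close>

lemma scaled_image_theta:
  fixes D :: "('x::finite, 'u, 'o) pomdp_data"
  assumes "scaled_image g p b"
  shows "scaled_image (phi D t u z \<circ> g) p (theta D t b u z)"
proof -
  obtain c where c: "\<And>y. pmf b (Some y) = c * pmf (map_pmf g p) (Some y)"
    using assms unfolding scaled_image_def by blast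
  have "pmf (map_pmf (phi D t u z) b) (Some y) = c * pmf (map_pmf (phi D t u z \<circ> g) p) (Some y)" for y
  proof -
    let ?V = "phi D t u z -` {Some y}"
    have "pmf (map_pmf (phi D t u z) b) (Some y) = (\<Sum>w\<in>?V. pmf b w)"
      by (simp add: pmf_map measure_measure_pmf_finite)
    also have "\<dots> = (\<Sum>w\<in>?V. c * pmf (map_pmf g p) w)"
      by (rule sum.cong) (auto simp: phi_eq_Some_iff c)
    also have "\<dots> = c * pmf (map_pmf (phi D t u z) (map_pmf g p)) (Some y)"
      unfolding pmf_map[of "phi D t u z"] by (subst measure_measure_pmf_finite) (simp_all add: sum_distrib_left)
    finally show ?thesis by (simp add: pmf.map_comp)
  qed
  then have "pmf (theta D t b u z) (Some y) =
      (c / obs_prob D t b u z) * pmf (map_pmf (phi D t u z \<circ> g) p) (Some y)" for y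
    by (simp add: pmf_theta_Some)
  then show ?thesis unfolding scaled_image_def by blast
qed

lemma reachable_scaled_image:
  fixes D :: "('x::finite, 'u, 'o) pomdp_data"
  assumes "b \<in> reachable D p (Suc t)"
  shows "\<exists>g\<in>Phi_upto D t. scaled_image g p b"
  using assms
proof (induction t arbitrary: b)
  case 0
  then obtain u z where b: "b = theta D 0 p u z" by auto
  \<comment> \<open>\<open>id\<close> need not belong to \<open>Phi D\<close>, so the induction
    starts after the first transition; hence \<open>t + 1\<close> transitions go with
    \<open>Phi_upto D t\<close>.\<close>
  have "scaled_image id p p"
    unfolding scaled_image_def by (rule exI[of _ 1]) (simp add: pmf.map_id0)
  from scaled_image_theta[OF this] have "scaled_image (phi D 0 u z) p b"
    by (simp add: b)
  then show ?case by (auto simp: Phi_stage_def)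
next
  case (Suc t)
  then obtain b' u z where b: "b = theta D (Suc t) b' u z" and b': "b' \<in> reachable D p (Suc t)"
    unfolding reachable.simps(2)[of D p "Suc t"] by blast
  obtain g where "g \<in> Phi_upto D t" "scaled_image g p b'"
    using Suc.IH[OF b'] by blast
  then have "scaled_image (phi D (Suc t) u z \<circ> g) p b"
    and "phi D (Suc t) u z \<circ> g \<in> Phi_upto D (Suc t)"
    by (auto simp: b scaled_image_theta Phi_stage_def)
  then show ?case by blast
qed

lemma reachable_beliefsD:
  fixes D :: "('x::finite, 'u, 'o) pomdp_data"
  assumes "b \<in> reachable_beliefs D p"
  shows "b \<in> beliefs" and "\<exists>g\<in>Phi D. scaled_image g p b"
proof -
  obtain t where t: "t < horizon D" and b: "b \<in> reachable D p (Suc t)"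
  proof -
    obtain s where s: "1 \<le> s" "s \<le> horizon D" "b \<in> reachable D p s"
      using assms unfolding reachable_beliefs_def by auto
    then obtain t where "s = Suc t" by (cases s) auto
    with s show thesis by (intro that[of t]) simp_all
  qed
  from b show "b \<in> beliefs" by (auto simp: theta_in_beliefs)
  from t reachable_scaled_image[OF b] show "\<exists>g\<in>Phi D. scaled_image g p b"
    by (auto simp: Phi_def)
qed

lemma pmf_None_belief:
  assumes "b \<in> beliefs" "b \<noteq> return_pmf None"
  shows "pmf b None = 0"
  using assms by (auto simp: beliefs_def pmf_eq_0_set_pmf)

text \<open>Rescaling creates no mass outside the image of the support, and \<open>b\<close> has no
  mass at \<open>None\<close>.\<close>

lemma set_pmf_scaled_image:
  assumes "b \<in> beliefs" "b \<noteq> return_pmf None" "scaled_image g (map_pmf Some p) b"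
  shows "set_pmf b \<subseteq> (\<lambda>x. g (Some x)) ` alive g p"
proof
  fix w assume w: "w \<in> set_pmf b"
  then obtain y where y: "w = Some y"
    using pmf_None_belief[OF assms(1,2)] by (cases w) (auto simp: set_pmf_iff)
  obtain c where "pmf b (Some y) = c * pmf (map_pmf g (map_pmf Some p)) (Some y)"
    using assms(3) unfolding scaled_image_def by blast
  with w y have "Some y \<in> set_pmf (map_pmf g (map_pmf Some p))"
    by (metis mult_zero_right set_pmf_iff)
  then show "w \<in> (\<lambda>x. g (Some x)) ` alive g p"
    unfolding y alive_def by (auto simp: image_iff) (metis option.distinct(1))
qed

text \<open>Agreement on the support makes both beliefs multiples of the same function
  \<open>m\<close> on states; total mass 1 there forces equal factors.\<close>

lemma scaled_image_unique:
  fixes p :: "'x::finite pmf"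
  assumes b1: "b1 \<in> beliefs" "b1 \<noteq> return_pmf None" "scaled_image g1 (map_pmf Some p) b1"
    and b2: "b2 \<in> beliefs" "b2 \<noteq> return_pmf None" "scaled_image g2 (map_pmf Some p) b2"
    and eq: "\<And>x. x \<in> set_pmf p \<Longrightarrow> g1 (Some x) = g2 (Some x)"
  shows "b1 = b2"
proof -
  define m where "m y = pmf (map_pmf g2 (map_pmf Some p)) (Some y)" for y
  have "map_pmf g1 (map_pmf Some p) = map_pmf g2 (map_pmf Some p)"
    unfolding pmf.map_comp by (rule map_pmf_cong) (auto simp: eq)
  then obtain c1 c2 where c1: "\<And>y. pmf b1 (Some y) = c1 * m y" and c2: "\<And>y. pmf b2 (Some y) = c2 * m y"
    using b1(3) b2(3) unfolding scaled_image_def m_def by metis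
  have total: "(\<Sum>y\<in>UNIV. pmf b (Some y)) = 1" if "b \<in> beliefs" "b \<noteq> return_pmf None" for b :: "'x option pmf"
  proof -
    have "(\<Sum>w\<in>UNIV. pmf b w) = 1" by (rule sum_pmf_eq_1) auto
    then show ?thesis
      using pmf_None_belief[OF that] by (simp add: UNIV_option_conv sum.reindex)
  qed
  have "c1 * sum m UNIV = 1" "c2 * sum m UNIV = 1"
    using total[OF b1(1,2)] total[OF b2(1,2)] by (simp_all add: c1 c2 sum_distrib_left)
  then have "c1 = c2"
    by (metis mult_cancel_right mult_zero_right zero_neq_one)
  show ?thesis
  proof (rule pmf_eqI)
    fix w show "pmf b1 w = pmf b2 w"
      by (cases w) (simp_all add: pmf_None_belief b1 b2 c1 c2 \<open>c1 = c2\<close>)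
  qed
qed

text \<open>On \<open>A\<close>, separation spreads the agreement at \<open>a\<close>; support
  points outside \<open>A\<close> are sent to \<open>None\<close> by both mappings.\<close>

lemma separated_eq_on_alive:
  assumes "separated_pair g1 g2" "alive g1 p = A" "alive g2 p = A"
    and "a \<in> A" "g1 (Some a) = g2 (Some a)" "x \<in> set_pmf p"
  shows "g1 (Some x) = g2 (Some x)"
proof (cases "x \<in> A")
  case True
  have A: "w \<in> A \<Longrightarrow> Some w \<in> g1 -` range Some \<inter> g2 -` range Some" for w
    using assms(2,3) unfolding alive_def by (fastforce simp: image_iff)
  show ?thesis
    using assms(1,5) A[OF assms(4)] A[OF True] unfolding separated_pair_def Let_def by blast
next
  case False
  then show ?thesis using assms unfolding alive_def by auto
qed

lemma card_non_singleton_subsets: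
  assumes "finite S"
  shows "int (card {A. A \<subseteq> S \<and> card A \<noteq> 1}) = 2 ^ card S - int (card S)"
proof -
  have "{A. A \<subseteq> S \<and> card A \<noteq> 1} = Pow S - (\<lambda>x. {x}) ` S"
    by (auto simp: card_1_singleton_iff)
  moreover have "card ((\<lambda>x. {x}) ` S) = card S"
    by (intro card_image) auto
  ultimately show ?thesis
    using assms by (simp add: card_Diff_subset card_Pow image_subset_iff of_nat_diff less_imp_le)
qed

theorem mainTheorem2:
  fixes D :: "('x::finite, 'u::finite, 'o::finite) pomdp_data"
    and b0 :: "'x pmf"
  assumes "separated_det_pomdp D"
  shows "int (card (reachable_beliefs D (map_pmf Some b0)))
           \<le> 1 + (2 ^ card (set_pmf b0) - int (card (set_pmf b0))) * int CARD('x)"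
proof -
  let ?p = "map_pmf Some b0"
  \<comment> \<open>The cemetery belief is set aside; it accounts for the summand 1 in the
    bound.\<close>
  define R where "R = reachable_beliefs D ?p - {return_pmf None}"
  define K where "K = {A. A \<subseteq> set_pmf b0 \<and> card A \<noteq> 1}"
  \<comment> \<open>A relation rather than a function: one belief may arise from several mappings
    with different surviving sets. The count only needs every belief to have a code and every code
    to determine its belief.\<close>
  define code where "code b = (\<lambda>(A, y).
      if A = {} then b = return_pmf (Some y)
      else \<exists>g\<in>Phi D. scaled_image g ?p b \<and> alive g b0 = A \<and> g (Some (SOME x. x \<in> A)) = Some y)"
    for b :: "'x option pmf"
  have sep: "separated_pair g1 g2" if "g1 \<in> Phi D" "g2 \<in> Phi D" for g1 g2
    using assms that by (auto simp: separated_det_pomdp_def separated_mapping_set_def)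
  have R: "b \<in> beliefs" "b \<noteq> return_pmf None" "\<exists>g\<in>Phi D. scaled_image g ?p b" if "b \<in> R" for b
    using that reachable_beliefsD by (auto simp: R_def)
  have "card R \<le> card (K \<times> (UNIV :: 'x set))"
  proof (rule card_le_if_inj_on_rel[where r = code])
    show "finite (K \<times> (UNIV :: 'x set))" by simp
  next
    fix b assume b: "b \<in> R"
    then obtain g where g: "g \<in> Phi D" "scaled_image g ?p b" using R(3) by blast
    have supp: "set_pmf b \<subseteq> (\<lambda>x. g (Some x)) ` alive g b0"
      using set_pmf_scaled_image R(1,2) b g(2) by blast
    then have ne: "alive g b0 \<noteq> {}" using set_pmf_not_empty[of b] by auto
    define a where "a = (SOME x. x \<in> alive g b0)"
    have a: "a \<in> alive g b0" unfolding a_def using ne by (simp add: some_in_eq)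
    then obtain y where y: "g (Some a) = Some y" by (auto simp: alive_def)
    show "\<exists>k. k \<in> K \<times> (UNIV :: 'x set) \<and> code b k"
    proof (cases "card (alive g b0) = 1")
      case True
      then have "alive g b0 = {a}" using a by (auto simp: card_1_singleton_iff)
      then have "b = return_pmf (Some y)"
        using supp y by (simp add: set_pmf_subset_singleton)
      \<comment> \<open>\<open>{}\<close> lies in \<open>K\<close> because its cardinality is
        0.\<close>
      then show ?thesis by (intro exI[of _ "({}, y)"]) (simp add: K_def code_def)
    next
      case False
      then have "alive g b0 \<in> K" by (auto simp: K_def alive_def)
      moreover have "code b (alive g b0, y)"
        using g ne y by (auto simp: code_def a_def)
      ultimately show ?thesis by blast
    qed
  next
    fix b1 b2 k
    assume b: "b1 \<in> R" "b2 \<in> R" and code: "code b1 k" "code b2 k"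
    obtain A y where k: "k = (A, y)" by (cases k)
    show "b1 = b2"
    proof (cases "A = {}")
      case True
      then show ?thesis using code by (simp add: code_def k)
    next
      case False
      \<comment> \<open>The choice depends on \<open>A\<close> alone, so both mappings are evaluated
        at the same point.\<close>
      let ?a = "SOME x. x \<in> A"
      have a: "?a \<in> A" using False by (simp add: some_in_eq)
      obtain g1 where g1: "g1 \<in> Phi D" "scaled_image g1 ?p b1" "alive g1 b0 = A" "g1 (Some ?a) = Some y"
        using code(1) False by (auto simp: code_def k)
      obtain g2 where g2: "g2 \<in> Phi D" "scaled_image g2 ?p b2" "alive g2 b0 = A" "g2 (Some ?a) = Some y"
        using code(2) False by (auto simp: code_def k)
      have "g1 (Some x) = g2 (Some x)" if "x \<in> set_pmf b0" for x
        using separated_eq_on_alive[OF sep[OF g1(1) g2(1)] g1(3) g2(3) a _ that] g1(4) g2(4) by simp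
      then show ?thesis
        using scaled_image_unique[OF R(1,2)[OF b(1)] g1(2) R(1,2)[OF b(2)] g2(2)] by blast
    qed
  qed
  also have "\<dots> = card K * CARD('x)" by (simp add: card_cartesian_product)
  finally have "int (card R) \<le> int (card K) * int CARD('x)"
    by (metis of_nat_le_iff of_nat_mult)
  moreover have "card (reachable_beliefs D ?p) \<le> 1 + card R"
    unfolding R_def by (simp add: card_Diff_singleton_if) arith
  moreover have "int (card K) = 2 ^ card (set_pmf b0) - int (card (set_pmf b0))"
    unfolding K_def by (rule card_non_singleton_subsets) simp
  ultimately show ?thesis by simp
qed

end
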